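(* Let $(S,\ast)$ be a commutative adequate partial semigroup and let $A\subseteq S$. If there is an idempotent $p\in\overline{A}\cap J_\delta(S)$, then $A$ is a $C$-set; that is, there exist functions $\alpha:\mathcal{P}_{f}(\mathcal{T})\rightarrow S$ and $H:\mathcal{P}_{f}(\mathcal{T})\rightarrow\mathcal{P}_{f}(\mathbb{N})$ such that (1) if $F,G\in\mathcal{P}_{f}(\mathcal{T})$ and $F\subsetneq G$, then $\max H(F)<\min H(G)$; and (2) whenever $m\in\mathbb{N}$, $G_{1}\subsetneq G_{2}\subsetneq\cdots\subsetneq G_{m}$ in $\mathcal{P}_{f}(\mathcal{T})$ and $f_i\in G_i$ for each $i\in\{1,\ldots,m\}$, the product $\prod_{i=1}^{m}\big(\alpha(G_{i})\ast\prod_{t\in H(G_{i})}f_i(t)\big)$ is defined and belongs to $A$.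
   Context: A partial semigroup is a pair $(S,\ast)$ where $\ast$ is an operation defined on a subset $X\subseteq S\times S$ such that for all $x,y,z\in S$, $(x\ast y)\ast z=x\ast(y\ast z)$ in the sense that if either side is defined then so is the other and they are equal; it is commutative if $x\ast y=y\ast x$ whenever defined. For $s\in S$, $\phi(s)=\{t\in S: s\ast t \text{ is defined}\}$; for finite nonempty $K\subseteq S$, $\sigma(K)=\bigcap_{s\in K}\phi(s)$. $(S,\ast)$ is adequate if $\sigma(K)\neq\emptyset$ for every finite nonempty $K\subseteq S$. $\mathcal{P}_f(X)$ denotes the set of finite nonempty subsets of $X$. For finite $W_1,W_2\subseteq S$, $W_1\ast W_2=\{w_1\ast w_2: w_1\in W_1, w_2\in W_2, w_1\ast w_2\text{ defined}\}$, and $W\ast a$ means $W\ast\{a\}$. A sequence $\langle y_n\rangle_{n=1}^\infty$ in $S$ is adequate if $\prod_{n\in F}y_n$ is defined for every $F\in\mathcal{P}_f(\mathbb{N})$ and for every $K\in\mathcal{P}_f(S)$ there is $m\in\mathbb{N}$ with $\{\prod_{n\in F}y_n: F\in\mathcal{P}_f(\mathbb{N}), \min F\ge m\}\subseteq\sigma(K)$. $\mathcal{T}$ is the set of all adequate sequences in $S$. Identify $\beta S$ with the set of ultrafilters on $S$, with topology generated by the sets $\overline{A}=\{p\in\beta S: A\in p\}$. Let $\delta S=\bigcap_{x\in S}\overline{\phi(x)}$. For $a\in S$ and $B\subseteq S$ let $a^{-1}B=\{t\in\phi(a): a\ast t\in B\}$; for $p\in\beta S$, $q\in\delta S$ define $p\ast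 q=\{B\subseteq S: \{a\in S: a^{-1}B\in q\}\in p\}$; this makes $\delta S$ a compact right topological semigroup, and an idempotent means $p\in\delta S$ with $p\ast p=p$. A set $B\subseteq S$ is a $J_\delta$-set if for every $F\in\mathcal{P}_f(\mathcal{T})$ and every $W\in\mathcal{P}_f(S)$ there exist $a\in\sigma(W)$ and $L\in\mathcal{P}_f(\mathbb{N})$ such that for each $f\in F$, $\prod_{t\in L}f(t)\in\sigma(W\ast a)$ and $a\ast\prod_{t\in L}f(t)\in B$. $J_\delta(S)=\{p\in\delta S: \text{every } B\in p \text{ is a } J_\delta\text{-set}\}$. *)

theory Defs
  imports Main
begin

text \<open>
  The partial semigroup is carried by a whole type \<open>'a\<close>; its partial operation is an
  option-valued function, with \<open>None\<close> meaning ``undefined''.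
  Equality of options expresses ``if either side is defined then so is the other and
  they are equal''.
\<close>

type_synonym 'a pop = "'a \<Rightarrow> 'a \<Rightarrow> 'a option"

definition pmult :: "'a pop \<Rightarrow> 'a option \<Rightarrow> 'a option \<Rightarrow> 'a option" where
  "pmult f u v = Option.bind u (\<lambda>x. Option.bind v (\<lambda>y. f x y))"

definition partial_semigroup :: "'a pop \<Rightarrow> bool" where
  "partial_semigroup f \<longleftrightarrow>
     (\<forall>x y z. pmult f (f x y) (Some z) = pmult f (Some x) (f y z))"

definition commutative :: "'a pop \<Rightarrow> bool" where
  "commutative f \<longleftrightarrow> (\<forall>x y. f x y = f y x)"

definition phi :: "'a pop \<Rightarrow> 'a \<Rightarrow> 'a set" where
  "phi f s = {t. f s t \<noteq> None}"

definition sigma :: "'a pop \<Rightarrow> 'a set \<Rightarrow> 'a set" where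
  "sigma f K = (\<Inter>s\<in>K. phi f s)"

definition Pf :: "'b set \<Rightarrow> 'b set set" where
  "Pf X = {F. finite F \<and> F \<noteq> {} \<and> F \<subseteq> X}"

definition adequate :: "'a pop \<Rightarrow> bool" where
  "adequate f \<longleftrightarrow> (\<forall>K\<in>Pf UNIV. sigma f K \<noteq> {})"

definition set_mult :: "'a pop \<Rightarrow> 'a set \<Rightarrow> 'a set \<Rightarrow> 'a set" where
  "set_mult f W1 W2 = {z. \<exists>w1\<in>W1. \<exists>w2\<in>W2. f w1 w2 = Some z}"

text \<open>
  Products of nonempty lists; by associativity the bracketing is irrelevant. The empty product is
  never used and is left undefined, as a partial semigroup need not have an identity.
\<close>

fun list_mult :: "'a pop \<Rightarrow> 'a option list \<Rightarrow> 'a option" where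
  "list_mult f [] = None"
| "list_mult f [u] = u"
| "list_mult f (u # v # us) = pmult f u (list_mult f (v # us))"

text \<open>
  The product of \<open>y n\<close> over \<open>n \<in> F\<close>, in increasing order of indices. Sequences are
  indexed from 0 rather than from 1, so the type \<open>nat\<close> plays the role of the index set
  of positive integers; only the order of the indices is ever used.
\<close>

definition seq_prod :: "'a pop \<Rightarrow> (nat \<Rightarrow> 'a) \<Rightarrow> nat set \<Rightarrow> 'a option" where
  "seq_prod f y F = list_mult f (map (\<lambda>n. Some (y n)) (sorted_list_of_set F))"

text \<open>
  From here on, \<open>v \<in> Some ` X\<close> says that the partial value \<open>v\<close> is defined and lies in \<open>X\<close>.
\<close>

definition adequate_seq :: "'a pop \<Rightarrow> (nat \<Rightarrow> 'a) \<Rightarrow> bool" where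
  "adequate_seq f y \<longleftrightarrow>
     (\<forall>F\<in>Pf UNIV. seq_prod f y F \<noteq> None) \<and>
     (\<forall>K\<in>Pf UNIV. \<exists>m. {seq_prod f y F | F. F \<in> Pf UNIV \<and> Min F \<ge> m} \<subseteq> Some ` sigma f K)"

definition adequate_seqs :: "'a pop \<Rightarrow> (nat \<Rightarrow> 'a) set" where
  "adequate_seqs f = {y. adequate_seq f y}"

definition ultrafilter :: "'a set set \<Rightarrow> bool" where
  "ultrafilter p \<longleftrightarrow>
     UNIV \<in> p \<and> {} \<notin> p \<and>
     (\<forall>A B. A \<in> p \<longrightarrow> A \<subseteq> B \<longrightarrow> B \<in> p) \<and>
     (\<forall>A B. A \<in> p \<longrightarrow> B \<in> p \<longrightarrow> A \<inter> B \<in> p) \<and>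
     (\<forall>A. A \<in> p \<or> - A \<in> p)"

definition beta_closure :: "'a set \<Rightarrow> 'a set set set" where
  "beta_closure A = {p. ultrafilter p \<and> A \<in> p}"

definition delta :: "'a pop \<Rightarrow> 'a set set set" where
  "delta f = (\<Inter>x. beta_closure (phi f x))"

definition left_quot :: "'a pop \<Rightarrow> 'a \<Rightarrow> 'a set \<Rightarrow> 'a set" where
  "left_quot f a B = {t \<in> phi f a. f a t \<in> Some ` B}"

definition uf_mult :: "'a pop \<Rightarrow> 'a set set \<Rightarrow> 'a set set \<Rightarrow> 'a set set" where
  "uf_mult f p q = {B. {a. left_quot f a B \<in> q} \<in> p}"

definition idempotent :: "'a pop \<Rightarrow> 'a set set \<Rightarrow> bool" where
  "idempotent f p \<longleftrightarrow> p \<in> delta f \<and> uf_mult f p p = p"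

definition J_delta_set :: "'a pop \<Rightarrow> 'a set \<Rightarrow> bool" where
  "J_delta_set f B \<longleftrightarrow>
     (\<forall>F\<in>Pf (adequate_seqs f). \<forall>W\<in>Pf UNIV. \<exists>a\<in>sigma f W. \<exists>L\<in>Pf UNIV. \<forall>y\<in>F.
        seq_prod f y L \<in> Some ` sigma f (set_mult f W {a}) \<and>
        pmult f (Some a) (seq_prod f y L) \<in> Some ` B)"

definition J_delta :: "'a pop \<Rightarrow> 'a set set set" where
  "J_delta f = {p \<in> delta f. \<forall>B\<in>p. J_delta_set f B}"

text \<open>
  The functions \<open>\<alpha>\<close> and \<open>H\<close> are total here; only their values on finite nonempty sets of
  adequate sequences matter.
\<close>

definition C_set :: "'a pop \<Rightarrow> 'a set \<Rightarrow> bool" where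
  "C_set f A \<longleftrightarrow>
     (\<exists>(\<alpha> :: (nat \<Rightarrow> 'a) set \<Rightarrow> 'a) (H :: (nat \<Rightarrow> 'a) set \<Rightarrow> nat set).
        (\<forall>F\<in>Pf (adequate_seqs f). H F \<in> Pf UNIV) \<and>
        (\<forall>F\<in>Pf (adequate_seqs f). \<forall>G\<in>Pf (adequate_seqs f).
           F \<subset> G \<longrightarrow> Max (H F) < Min (H G)) \<and>
        (\<forall>(m::nat) (G :: nat \<Rightarrow> (nat \<Rightarrow> 'a) set) (g :: nat \<Rightarrow> nat \<Rightarrow> 'a).
           m \<ge> 1 \<longrightarrow>
           (\<forall>i\<in>{1..m}. G i \<in> Pf (adequate_seqs f)) \<longrightarrow>
           (\<forall>i\<in>{1..<m}. G i \<subset> G (Suc i)) \<longrightarrow>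
           (\<forall>i\<in>{1..m}. g i \<in> G i) \<longrightarrow>
           list_mult f (map (\<lambda>i. pmult f (Some (\<alpha> (G i))) (seq_prod f (g i) (H (G i))))
             [1..<Suc m]) \<in> Some ` A))"

end

(*
  Write A* for the set of x in A with x^{-1}A in p. Idempotence of p gives A* in p and
  x^{-1}A* in p for every x in A*. The values alpha(F), H(F) are chosen by recursion on
  proper inclusion: if R is the finite set of products along chains below F, all of them in A*,
  then the intersection of A* with the sets x^{-1}A* for x in R lies in p, hence is a J_delta-set.
  Applying its defining property to the sequences of F shifted far enough to the right yields
  alpha(F) and an H(F) beyond all earlier ones.
*)
theory Submission
  imports Defs
begin

section \<open>Associativity and products of lists\<close>

lemma pmult_assoc:
  assumes "partial_semigroup f"
  shows "pmult f (pmult f u v) w = pmult f u (pmult f v w)"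
proof (cases "u = None \<or> v = None \<or> w = None")
  case True
  then show ?thesis by (cases u; cases v) (auto simp: pmult_def split: Option.bind_splits)
next
  case False
  then obtain x y z where "u = Some x" "v = Some y" "w = Some z" by auto
  moreover have "pmult f (f x y) (Some z) = pmult f (Some x) (f y z)"
    using assms by (simp add: partial_semigroup_def)
  ultimately show ?thesis by (simp add: pmult_def)
qed

text \<open>\<open>list_mult\<close> splits off the first factor, while a chain grows at its last
  one; associativity moves the split to the other end.\<close>

lemma list_mult_snoc:
  assumes "partial_semigroup f" "us \<noteq> []"
  shows "list_mult f (us @ [v]) = pmult f (list_mult f us) v"
  using assms(2)
proof (induction us rule: induct_list012)
  case (3 x y zs)
  then show ?case by (simp add: pmult_assoc[OF assms(1)])
qed simp_all

section \<open>Shifted sequences\<close>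

lemma sorted_list_of_set_shift:
  fixes L :: "nat set"
  assumes "finite L"
  shows "sorted_list_of_set ((+) k ` L) = map ((+) k) (sorted_list_of_set L)"
  proof (rule sorted_distinct_set_unique)
  show "sorted (map ((+) k) (sorted_list_of_set L))"
    by (simp add: sorted_map)
  show "distinct (map ((+) k) (sorted_list_of_set L))"
    by (simp add: distinct_map)
qed (use assms in simp_all)

lemma seq_prod_shift:
  assumes "finite L"
  shows "seq_prod f (\<lambda>n. y (k + n)) L = seq_prod f y ((+) k ` L)"
  using assms by (simp add: seq_prod_def sorted_list_of_set_shift comp_def)

text \<open>A product of the shifted sequence over \<open>F\<close> is a product of \<open>y\<close>
  over the translate of \<open>F\<close> by \<open>k\<close>. Translation does not lower the
  minimum, so the threshold that works for \<open>y\<close> and \<open>K\<close> still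
  works.\<close>

lemma adequate_seq_shift:
  assumes "adequate_seq f y"
  shows "adequate_seq f (\<lambda>n. y (k + n))"
proof -
  have shift: "(+) k ` F \<in> Pf UNIV" "Min ((+) k ` F) \<ge> Min F"
    "seq_prod f (\<lambda>n. y (k + n)) F = seq_prod f y ((+) k ` F)"
    if "F \<in> Pf UNIV" for F
  proof -
    have fin: "finite F" "F \<noteq> {}" using that by (auto simp: Pf_def)
    then show "(+) k ` F \<in> Pf UNIV" by (simp add: Pf_def)
    show "Min ((+) k ` F) \<ge> Min F" using fin by (auto simp: trans_le_add2)
    show "seq_prod f (\<lambda>n. y (k + n)) F = seq_prod f y ((+) k ` F)"
      using fin by (simp add: seq_prod_shift)
  qed
  show ?thesis
    unfolding adequate_seq_def
  proof (intro conjI ballI)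
    fix F :: "nat set"
    assume "F \<in> Pf UNIV"
    then show "seq_prod f (\<lambda>n. y (k + n)) F \<noteq> None"
      using shift assms by (simp add: adequate_seq_def)
  next
    fix K :: "'a set"
    assume "K \<in> Pf UNIV"
    then obtain m
      where m: "{seq_prod f y F | F. F \<in> Pf UNIV \<and> Min F \<ge> m} \<subseteq> Some ` sigma f K"
      using assms by (auto simp: adequate_seq_def)
    have "seq_prod f (\<lambda>n. y (k + n)) F \<in> Some ` sigma f K" if "F \<in> Pf UNIV" "m \<le> Min F" for F
      proof -
      have "(+) k ` F \<in> Pf UNIV" "m \<le> Min ((+) k ` F)"
        using shift(1,2)[OF that(1)] that(2) by auto
      then show ?thesis using m shift(3)[OF that(1)] by auto
    qed
    then show "\<exists>m. {seq_prod f (\<lambda>n. y (k + n)) F | F. F \<in> Pf UNIV \<and> Min F \<ge> m} \<subseteq> Some ` sigma f K"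
      by blast
  qed
qed

lemma J_delta_set_beyond:
  assumes "J_delta_set f B" "F \<in> Pf (adequate_seqs f)"
  shows "\<exists>a L. L \<in> Pf UNIV \<and> m < Min L \<and> (\<forall>y\<in>F. pmult f (Some a) (seq_prod f y L) \<in> Some ` B)"
proof -
  \<comment> \<open>Indices start at 0, so the shift is by \<open>Suc m\<close>: this keeps the
    inequality strict even if 0 lies in \<open>L\<close>.\<close>
  let ?shift = "\<lambda>y n. y (Suc m + n)"
  have "?shift ` F \<in> Pf (adequate_seqs f)"
    using assms(2) adequate_seq_shift[of f _ "Suc m"] by (auto simp: Pf_def adequate_seqs_def)
  \<comment> \<open>An arbitrary singleton serves as the finite nonempty set \<open>W\<close> of the
    definition.\<close>
  moreover have "{undefined} \<in> Pf UNIV" by (simp add: Pf_def)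
  ultimately obtain a L where L: "L \<in> Pf UNIV"
    and aL: "\<forall>z\<in>?shift ` F. pmult f (Some a) (seq_prod f z L) \<in> Some ` B"
    using assms(1)[unfolded J_delta_set_def, THEN bspec, THEN bspec, of "?shift ` F" "{undefined}"]
    by blast
  have fin: "finite L" "L \<noteq> {}" using L by (auto simp: Pf_def)
  show ?thesis
  proof (intro exI conjI ballI)
    show "(+) (Suc m) ` L \<in> Pf UNIV" using fin by (simp add: Pf_def)
    show "m < Min ((+) (Suc m) ` L)" using fin by auto
    show "pmult f (Some a) (seq_prod f y ((+) (Suc m) ` L)) \<in> Some ` B" if "y \<in> F" for y
      using aL that seq_prod_shift[OF fin(1), of f y "Suc m"] by auto
  qed
qed

section \<open>Idempotent ultrafilters and the star set\<close>

lemma ultrafilter_Int_INT: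
  assumes "ultrafilter p" "finite R" "A \<in> p" "\<And>x. x \<in> R \<Longrightarrow> B x \<in> p"
  shows "A \<inter> (\<Inter>x\<in>R. B x) \<in> p"
  using assms(2,4)
proof (induction R rule: finite_induct)
  case empty
  then show ?case using assms(3) by simp
next
  case (insert x R)
  then have "B x \<inter> (A \<inter> (\<Inter>x\<in>R. B x)) \<in> p"
    using assms(1) by (simp add: ultrafilter_def)
  then show ?case by (simp add: Int_left_commute)
qed

definition star_set :: "'a pop \<Rightarrow> 'a set set \<Rightarrow> 'a set \<Rightarrow> 'a set" where
  "star_set f p A = {x \<in> A. left_quot f x A \<in> p}"

lemma star_set_mem:
  assumes "ultrafilter p" "uf_mult f p p = p" "A \<in> p"
  shows "star_set f p A \<in> p"
proof -
  have "{x. left_quot f x A \<in> p} \<in> p" using assms(2,3) by (auto simp: uf_mult_def)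
  moreover have "star_set f p A = A \<inter> {x. left_quot f x A \<in> p}" by (auto simp: star_set_def)
  ultimately show ?thesis using assms(1,3) unfolding ultrafilter_def by metis
qed

text \<open>Associativity is an equality of options, so both sides agree on where the products are
  defined as well as on their values.\<close>

lemma left_quot_left_quot:
  assumes "partial_semigroup f" "f x y = Some z"
  shows "left_quot f y (left_quot f x A) = left_quot f z A"
proof -
  have "f z t = pmult f (Some x) (f y t)" for t
    using assms unfolding partial_semigroup_def by (metis bind.bind_lunit pmult_def)
  then show ?thesis by (auto simp: left_quot_def phi_def pmult_def split: Option.bind_splits)
qed

text \<open>As x^{-1}A is in \<open>p\<close>, so is its own star set. A member y of that has xy in
  \<open>A\<close> and y^{-1}(x^{-1}A) = (xy)^{-1}A in \<open>p\<close>, which says that xy lies in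
  the star set of \<open>A\<close>.\<close>

lemma left_quot_star_set_mem:
  assumes "partial_semigroup f" "ultrafilter p" "uf_mult f p p = p" "x \<in> star_set f p A"
  shows "left_quot f x (star_set f p A) \<in> p"
proof -
  have "star_set f p (left_quot f x A) \<in> p"
    using assms star_set_mem by (auto simp: star_set_def)
  moreover have "star_set f p (left_quot f x A) \<subseteq> left_quot f x (star_set f p A)"
  proof
    fix y
    assume y: "y \<in> star_set f p (left_quot f x A)"
    then obtain z where z: "f x y = Some z" "z \<in> A"
      by (auto simp: star_set_def left_quot_def)
    then have "z \<in> star_set f p A"
      using y left_quot_left_quot[OF assms(1) z(1)] by (simp add: star_set_def)
    then show "y \<in> left_quot f x (star_set f p A)"
      using z by (simp add: left_quot_def phi_def)
  qed
  ultimately show ?thesis using assms(2) unfolding ultrafilter_def by blast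
qed

section \<open>Recursive choice along proper inclusion\<close>

text \<open>This is one step of the recursion, with \<open>R\<close> the products built so far. The
  same \<open>a\<close> and \<open>L\<close> serve all \<open>y\<close> in \<open>F\<close>; only
  the new factor \<open>v\<close> depends on \<open>y\<close>. It lies in the star set itself, to
  start a chain, and in every x^{-1}A* with x in \<open>R\<close>, to prolong one.\<close>

lemma star_set_extend:
  assumes "partial_semigroup f" "p \<in> J_delta f" "ultrafilter p" "uf_mult f p p = p" "A \<in> p"
    and "finite R" "R \<subseteq> star_set f p A" "F \<in> Pf (adequate_seqs f)"
  shows "\<exists>a L. L \<in> Pf UNIV \<and> m < Min L \<and>
    (\<forall>y\<in>F. \<exists>v\<in>star_set f p A. pmult f (Some a) (seq_prod f y L) = Some v \<and>
       (\<forall>x\<in>R. f x v \<in> Some ` star_set f p A))"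
proof -
  let ?A = "star_set f p A"
  let ?B = "?A \<inter> (\<Inter>x\<in>R. left_quot f x ?A)"
  have "?B \<in> p"
    using assms by (intro ultrafilter_Int_INT star_set_mem left_quot_star_set_mem) auto
  then have "J_delta_set f ?B" using assms(2) by (auto simp: J_delta_def)
  from J_delta_set_beyond[OF this assms(8), of m] obtain a L
    where L: "L \<in> Pf UNIV" "m < Min L"
      and aL: "\<forall>y\<in>F. pmult f (Some a) (seq_prod f y L) \<in> Some ` ?B"
    by blast
  have "\<forall>y\<in>F. \<exists>v\<in>?A. pmult f (Some a) (seq_prod f y L) = Some v \<and> (\<forall>x\<in>R. f x v \<in> Some ` ?A)"
  proof
    fix y
    assume "y \<in> F"
    then obtain v where "pmult f (Some a) (seq_prod f y L) = Some v" "v \<in> ?B"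
      using aL by blast
    then show "\<exists>v\<in>?A. pmult f (Some a) (seq_prod f y L) = Some v \<and> (\<forall>x\<in>R. f x v \<in> Some ` ?A)"
      by (auto simp: left_quot_def)
  qed
  with L show ?thesis by blast
qed

text \<open>
  The recursion chooses, besides \<open>\<alpha> F\<close> and \<open>H F\<close>, a finite set \<open>Q F\<close> containing
  all products along chains with top element \<open>F\<close>.
\<close>

lemma exists_chain_choice:
  assumes "partial_semigroup f" "p \<in> J_delta f" "ultrafilter p" "uf_mult f p p = p" "A \<in> p"
  obtains \<alpha> H Q where
    "\<And>F. F \<in> Pf (adequate_seqs f) \<Longrightarrow> H F \<in> Pf UNIV"
    "\<And>F. F \<in> Pf (adequate_seqs f) \<Longrightarrow> Q F \<subseteq> A"
    "\<And>F G. F \<in> Pf (adequate_seqs f) \<Longrightarrow> G \<in> Pf (adequate_seqs f) \<Longrightarrow> G \<subset> F \<Longrightarrow>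
      Max (H G) < Min (H F)"
    "\<And>F y. F \<in> Pf (adequate_seqs f) \<Longrightarrow> y \<in> F \<Longrightarrow>
      \<exists>v\<in>Q F. pmult f (Some (\<alpha> F)) (seq_prod f y (H F)) = Some v \<and>
        (\<forall>G\<in>Pf (adequate_seqs f). G \<subset> F \<longrightarrow> (\<forall>x\<in>Q G. f x v \<in> Some ` Q F))"
proof -
  let ?T = "Pf (adequate_seqs f)"
  let ?A = "star_set f p A"
  \<comment> \<open>\<open>P h F r\<close> says that the triple \<open>r\<close> is admissible at
    \<open>F\<close>, given the values of \<open>h\<close> on proper subsets of \<open>F\<close>. It
    is vacuous outside \<open>?T\<close>, so that \<open>h\<close> can be total.\<close>
  define P where "P h F r \<longleftrightarrow> F \<in> ?T \<longrightarrow>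
    (case r of (a, L, Q) \<Rightarrow> L \<in> Pf UNIV \<and> finite Q \<and> Q \<subseteq> ?A \<and>
      (\<forall>y\<in>F. \<exists>v\<in>Q. pmult f (Some a) (seq_prod f y L) = Some v \<and>
         (\<forall>G\<in>?T. G \<subset> F \<longrightarrow> (\<forall>x\<in>snd (snd (h G)). f x v \<in> Some ` Q))) \<and>
      (\<forall>G\<in>?T. G \<subset> F \<longrightarrow> Max (fst (snd (h G))) < Min L))"
    for h :: "(nat \<Rightarrow> 'a) set \<Rightarrow> 'a \<times> nat set \<times> 'a set" and F r
  have "\<exists>h. \<forall>F. P h F (h F)"
  \<comment> \<open>\<open>finite_psubset\<close> requires the larger set to be finite, which makes
    it well-founded on all sets; below a member of \<open>?T\<close> it is plain proper
    inclusion.\<close>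
  proof (rule dependent_wf_choice[OF wf_finite_psubset])
    fix h g :: "(nat \<Rightarrow> 'a) set \<Rightarrow> 'a \<times> nat set \<times> 'a set" and F r
    assume "\<And>G. (G, F) \<in> finite_psubset \<Longrightarrow> h G = g G"
    then have "h G = g G" if "F \<in> ?T" "G \<subset> F" for G
      using that by (simp add: Pf_def)
    then show "P h F r = P g F r" unfolding P_def by (simp cong: conj_cong imp_cong)
  next
    fix F and h :: "(nat \<Rightarrow> 'a) set \<Rightarrow> 'a \<times> nat set \<times> 'a set"
    assume IH: "\<And>G. (G, F) \<in> finite_psubset \<Longrightarrow> P h G (h G)"
    show "\<exists>r. P h F r"
    proof (cases "F \<in> ?T")
      case False
      then show ?thesis by (simp add: P_def)
    next
      case True
      let ?D = "{G \<in> ?T. G \<subset> F}"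
      define R where "R = (\<Union>G\<in>?D. snd (snd (h G)))"
      \<comment> \<open>The inserted 0 covers a singleton \<open>F\<close>, which has no nonempty
        proper subset and hence an empty \<open>?D\<close>.\<close>
      define m where "m = Max (insert 0 ((\<lambda>G. Max (fst (snd (h G)))) ` ?D))"
      have "finite F" using True by (simp add: Pf_def)
      then have finD: "finite ?D" by (rule_tac finite_subset[of _ "Pow F"]) auto
      have below: "finite (snd (snd (h G))) \<and> snd (snd (h G)) \<subseteq> ?A" if "G \<in> ?D" for G
        using IH[of G] that \<open>finite F\<close> by (auto simp: P_def split: prod.splits)
      have R: "finite R" "R \<subseteq> ?A" using finD below by (auto simp: R_def)
      have m: "Max (fst (snd (h G))) \<le> m" if "G \<in> ?D" for G
        unfolding m_def using finD that by (intro Max_ge) auto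
      from star_set_extend[OF assms R True, of m] obtain a L where L: "L \<in> Pf UNIV" "m < Min L"
        and aL: "\<forall>y\<in>F. \<exists>v\<in>?A. pmult f (Some a) (seq_prod f y L) = Some v \<and>
          (\<forall>x\<in>R. f x v \<in> Some ` ?A)"
        by blast
      define v where "v y = the (pmult f (Some a) (seq_prod f y L))" for y
      have v: "pmult f (Some a) (seq_prod f y L) = Some (v y)" "v y \<in> ?A"
        "\<And>x. x \<in> R \<Longrightarrow> f x (v y) \<in> Some ` ?A" if "y \<in> F" for y
        using aL that by (auto simp: v_def)
      \<comment> \<open>The first part holds the products of chains consisting of \<open>F\<close>
        alone, the second those prolonging a chain below \<open>F\<close>. Each \<open>the\<close>
        is applied to a defined value, by the third fact of \<open>v\<close>.\<close>
      define Q where "Q = v ` F \<union> (\<lambda>(x, y). the (f x (v y))) ` (R \<times> F)"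
      have "finite Q" using R(1) \<open>finite F\<close> by (simp add: Q_def)
      moreover have "Q \<subseteq> ?A" using v(2,3) by (fastforce simp: Q_def)
      moreover have "v y \<in> Q" if "y \<in> F" for y using that by (simp add: Q_def)
      moreover have "f x (v y) \<in> Some ` Q"
        if "y \<in> F" "G \<in> ?T" "G \<subset> F" "x \<in> snd (snd (h G))" for x y G
      proof -
        have "x \<in> R" using that by (auto simp: R_def)
        then show ?thesis using v(3)[OF that(1)] that(1) by (force simp: Q_def)
      qed
      moreover have "Max (fst (snd (h G))) < Min L" if "G \<in> ?T" "G \<subset> F" for G
        using m[of G] L(2) that by simp
      ultimately have "P h F (a, L, Q)"
        unfolding P_def prod.case using L(1) v(1) by (intro impI conjI ballI bexI) simp_all
      then show ?thesis ..
    qed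
  qed
  then obtain h where h: "\<forall>F. P h F (h F)" ..
  have "?A \<subseteq> A" by (auto simp: star_set_def)
  show thesis
  proof (rule that[of "\<lambda>F. fst (snd (h F))" "\<lambda>F. snd (snd (h F))" "\<lambda>F. fst (h F)"])
    fix F
    assume F: "F \<in> ?T"
    note hF = h[THEN spec, of F, unfolded P_def case_prod_unfold, THEN mp, OF F]
    show "fst (snd (h F)) \<in> Pf UNIV" using hF by (elim conjE)
    show "snd (snd (h F)) \<subseteq> A" using hF \<open>?A \<subseteq> A\<close> by (elim conjE) (rule subset_trans)
    show "Max (fst (snd (h G))) < Min (fst (snd (h F)))" if "G \<in> ?T" "G \<subset> F" for G
      using hF that by (elim conjE) (drule bspec, assumption, erule mp)
    show "\<exists>v\<in>snd (snd (h F)). pmult f (Some (fst (h F))) (seq_prod f y (fst (snd (h F)))) = Some v \<and>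
        (\<forall>G\<in>?T. G \<subset> F \<longrightarrow> (\<forall>x\<in>snd (snd (h G)). f x v \<in> Some ` snd (snd (h F))))"
      if "y \<in> F" for y
      using hF that by (elim conjE) (erule bspec)
  qed
qed

section \<open>Products along chains\<close>

theorem theorem3p4:
  fixes f :: "'a \<Rightarrow> 'a \<Rightarrow> 'a option" and A :: "'a set"
  assumes "partial_semigroup f" and "commutative f" and "adequate f"
    and "\<exists>p. p \<in> beta_closure A \<inter> J_delta f \<and> idempotent f p"
  shows "C_set f A"
proof -
  let ?T = "Pf (adequate_seqs f)"
  obtain p where p: "p \<in> J_delta f" "ultrafilter p" "uf_mult f p p = p" "A \<in> p"
    using assms(4) by (auto simp: beta_closure_def idempotent_def)
  obtain \<alpha> H Q where H: "\<And>F. F \<in> ?T \<Longrightarrow> H F \<in> Pf UNIV"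
      "\<And>F G. F \<in> ?T \<Longrightarrow> G \<in> ?T \<Longrightarrow> G \<subset> F \<Longrightarrow> Max (H G) < Min (H F)"
    and Q: "\<And>F. F \<in> ?T \<Longrightarrow> Q F \<subseteq> A"
      "\<And>F y. F \<in> ?T \<Longrightarrow> y \<in> F \<Longrightarrow>
        \<exists>v\<in>Q F. pmult f (Some (\<alpha> F)) (seq_prod f y (H F)) = Some v \<and>
          (\<forall>G\<in>?T. G \<subset> F \<longrightarrow> (\<forall>x\<in>Q G. f x v \<in> Some ` Q F))"
    by (rule exists_chain_choice[OF assms(1) p]) (rule that)
  \<comment> \<open>Membership in \<open>Q (G m)\<close> rather than just in \<open>A\<close> is
    what the induction needs: the factor chosen at the next set is compatible with exactly these
    elements.\<close>
  have chain: "list_mult f (map (\<lambda>i. pmult f (Some (\<alpha> (G i))) (seq_prod f (g i) (H (G i))))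
      [1..<Suc m]) \<in> Some ` Q (G m)"
    if "m \<ge> 1" "\<forall>i\<in>{1..m}. G i \<in> ?T" "\<forall>i\<in>{1..<m}. G i \<subset> G (Suc i)" "\<forall>i\<in>{1..m}. g i \<in> G i"
    for m :: nat and G :: "nat \<Rightarrow> (nat \<Rightarrow> 'a) set" and g :: "nat \<Rightarrow> nat \<Rightarrow> 'a"
    using that
  proof (induction m rule: nat_induct_at_least)
    case base
    then have "G 1 \<in> ?T" "g 1 \<in> G 1" by auto
    then show ?case using Q(2)[of "G 1" "g 1"] by auto
  next
    case (Suc m)
    let ?u = "\<lambda>i. pmult f (Some (\<alpha> (G i))) (seq_prod f (g i) (H (G i)))"
    obtain x where x: "list_mult f (map ?u [1..<Suc m]) = Some x" "x \<in> Q (G m)"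
      using Suc by auto
    have G: "G m \<in> ?T" "G (Suc m) \<in> ?T" "G m \<subset> G (Suc m)" "g (Suc m) \<in> G (Suc m)"
      using Suc by auto
    \<comment> \<open>As \<open>G m\<close> is a proper subset of \<open>G (Suc m)\<close>, the
      product \<open>x\<close> so far is among the elements that the new factor \<open>v\<close> can
      follow.\<close>
    obtain v where v: "?u (Suc m) = Some v" "f x v \<in> Some ` Q (G (Suc m))"
      using Q(2)[OF G(2,4)] G(1,3) x(2) by blast
    have "list_mult f (map ?u [1..<Suc (Suc m)]) = list_mult f (map ?u [1..<Suc m] @ [?u (Suc m)])"
      by simp
    also have "\<dots> = pmult f (Some x) (Some v)"
      using Suc.hyps x(1) v(1) by (subst list_mult_snoc[OF assms(1)]) auto
    also have "\<dots> = f x v" by (simp add: pmult_def)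
    finally show ?case using v(2) by simp
  qed
  show ?thesis
    unfolding C_set_def
  proof (intro exI conjI allI impI)
    show "\<forall>F\<in>?T. H F \<in> Pf UNIV" using H(1) by blast
    show "\<forall>F\<in>?T. \<forall>G\<in>?T. F \<subset> G \<longrightarrow> Max (H F) < Min (H G)" using H(2) by blast
    fix m :: nat and G :: "nat \<Rightarrow> (nat \<Rightarrow> 'a) set" and g :: "nat \<Rightarrow> nat \<Rightarrow> 'a"
    assume hyps: "m \<ge> 1" "\<forall>i\<in>{1..m}. G i \<in> ?T" "\<forall>i\<in>{1..<m}. G i \<subset> G (Suc i)"
      "\<forall>i\<in>{1..m}. g i \<in> G i"
    then have "Q (G m) \<subseteq> A" using Q(1)[of "G m"] by auto
    then show "list_mult f (map (\<lambda>i. pmult f (Some (\<alpha> (G i))) (seq_prod f (g i) (H (G i))))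
        [1..<Suc m]) \<in> Some ` A"
      using chain[OF hyps] by blast
  qed
qed

end
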